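(* For every integer $n\ge0$ and arbitrary (complex, or indeterminate) parameters $s,t$, the $(s,t)$-Eulerian polynomials $A_n^{(s,t)}$ satisfy, as an identity of power series in $x$, $$\frac{x\,A_n^{(s,t)}(x)}{(1-x)^{n+s+t}}=\sum_{k\ge1}\frac{(s+t)^{\overline{k-1}}}{(k-1)!}\,(k+s-1)^n\,x^k .$$
   Context: The $(s,t)$-Eulerian numbers are defined by $$E_{(s,t)}(n,k)=(k+s)\,E_{(s,t)}(n-1,k)+(n-k+t)\,E_{(s,t)}(n-1,k-1)+\delta_{k0}\delta_{n0},$$ with $E_{(s,t)}(n,k)=0$ if $n<0$ or $k<0$, and the $(s,t)$-Eulerian polynomials are $A_n^{(s,t)}(x)=\sum_{k=0}^nE_{(s,t)}(n,k)\,x^k$. Notation: $x^{\overline{j}}=x(x+1)\cdots(x+j-1)$ is the raising factorial (equal to $1$ for $j=0$). The power $(1-x)^{-a}$ is understood as its binomial series $\sum_{j\ge0}\frac{a^{\overline{j}}}{j!}x^j$. Convention: $0^0=1$. *)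

theory Defs
  imports "HOL-Computational_Algebra.Computational_Algebra"
begin

(* Indices are integers, so that the boundary convention (value 0 at a negative index)
   is part of the definition, and of_int (n - k) is a genuine difference. *)

function st_eulerian :: "'a::field_char_0 \<Rightarrow> 'a \<Rightarrow> int \<Rightarrow> int \<Rightarrow> 'a" where
  "st_eulerian s t n k =
     (if n < 0 \<or> k < 0 then 0
      else (of_int k + s) * st_eulerian s t (n - 1) k
         + (of_int (n - k) + t) * st_eulerian s t (n - 1) (k - 1)
         + (if k = 0 \<and> n = 0 then 1 else 0))"
  by pat_completeness auto
termination
  by (relation "Wellfounded.measure (\<lambda>(s, t, n, k). nat (n + 1))") auto

(* As an unconditional rewrite rule the defining equation would loop. *)
declare st_eulerian.simps [simp del]

definition st_eulerian_poly :: "'a::field_char_0 \<Rightarrow> 'a \<Rightarrow> nat \<Rightarrow> 'a poly" where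
  "st_eulerian_poly s t n = (\<Sum>k=0..n. monom (st_eulerian s t (int n) (int k)) k)"

(* The power series of (1 - x) to the power -a; here pochhammer is the raising factorial. *)
definition one_minus_X_powr_neg :: "'a::field_char_0 \<Rightarrow> 'a fps" where
  "one_minus_X_powr_neg a = Abs_fps (\<lambda>j. pochhammer a j / fact j)"

lemma one_minus_X_powr_neg_conv_fps_binomial:
  "one_minus_X_powr_neg a = fps_binomial (- a) oo (- fps_X)"
  by (rule fps_ext)
     (simp add: one_minus_X_powr_neg_def fps_compose_uminus' gbinomial_pochhammer
        flip: power_mult_distrib mult.assoc)

end

theory Submission
  imports Defs
begin

text \<open>
  Write \<open>A\<^sub>n\<close> for the polynomial and \<open>F\<^sub>n = A\<^sub>n (1 - x)\<^sup>-\<^sup>a\<close> with \<open>a = n + s + t\<close>. The recurrence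
  of the numbers, read on generating functions, is
  \<open>A\<^sub>n\<^sub>+\<^sub>1 = (s + (n + t) x) A\<^sub>n + x (1 - x) A\<^sub>n'\<close> (\<open>st_eulerian_poly_Suc\<close>). The power of \<open>1 - x\<close> is chosen to absorb
  the awkward factors: differentiating \<open>F\<^sub>n\<close> gives exactly \<open>F\<^sub>n\<^sub>+\<^sub>1 = s F\<^sub>n + x F\<^sub>n'\<close>
  (\<open>st_eulerian_quotient_Suc\<close>). The operator \<open>s + x d/dx\<close> is diagonal on the monomials, with eigenvalue \<open>j + s\<close> at \<open>x\<^sup>j\<close>, so \<open>n\<close>
  applications to \<open>F\<^sub>0 = (1 - x)\<^sup>-\<^sup>(\<^sup>s\<^sup>+\<^sup>t\<^sup>)\<close> multiply its \<open>j\<close>-th coefficient by \<open>(j + s)\<^sup>n\<close>.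
  Multiplication by \<open>x\<close> shifts the index to \<open>k = j + 1\<close>.
\<close>

lemma st_eulerian_row_0:
  "st_eulerian s t 0 (int k) = (if k = 0 then 1 else 0)"
  by (simp add: st_eulerian.simps[of s t 0] st_eulerian.simps[of s t "-1"])

lemma st_eulerian_Suc_0:
  "st_eulerian s t (int (Suc n)) 0 = s * st_eulerian s t (int n) 0"
  by (subst st_eulerian.simps) (simp add: st_eulerian.simps[of s t _ "-1"])

lemma st_eulerian_Suc_Suc:
  "st_eulerian s t (int (Suc n)) (int (Suc k)) =
     (of_nat (Suc k) + s) * st_eulerian s t (int n) (int (Suc k))
     + (of_nat n - of_nat k + t) * st_eulerian s t (int n) (int k)"
  by (subst st_eulerian.simps) simp

lemma st_eulerian_eq_0:
  "n < k \<Longrightarrow> st_eulerian s t (int n) (int k) = 0"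
proof (induction n arbitrary: k)
  case 0
  then show ?case using st_eulerian_row_0[of s t k] by simp
next
  case (Suc n)
  then obtain j where "k = Suc j" "n < j" by (cases k) auto
  then show ?case using Suc.IH[of j] Suc.IH[of "Suc j"] by (simp only: st_eulerian_Suc_Suc) simp
qed

lemma coeff_st_eulerian_poly:
  "coeff (st_eulerian_poly s t n) k = st_eulerian s t (int n) (int k)"
proof -
  have "coeff (st_eulerian_poly s t n) k =
          (\<Sum>i=0..n. if i = k then st_eulerian s t (int n) (int i) else 0)"
    by (simp add: st_eulerian_poly_def coeff_sum)
  also have "\<dots> = (if k \<le> n then st_eulerian s t (int n) (int k) else 0)"
    by (simp add: sum.delta)
  finally show ?thesis
    by (simp add: st_eulerian_eq_0)
qed

lemma st_eulerian_poly_0: "st_eulerian_poly s t 0 = 1"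
proof (rule poly_eqI)
  fix k
  show "coeff (st_eulerian_poly s t 0) k = coeff 1 k"
    using st_eulerian_row_0[of s t k] by (auto simp: coeff_st_eulerian_poly)
qed

text \<open>
  The factor \<open>n - k + t\<close> of the recurrence contributes \<open>(n + t) x A\<^sub>n\<close> minus \<open>x\<^sup>2 A\<^sub>n'\<close>, and the
  factor \<open>k + s\<close> contributes \<open>s A\<^sub>n\<close> plus \<open>x A\<^sub>n'\<close>.
\<close>

lemma st_eulerian_poly_Suc:
  fixes s t :: "'a::field_char_0" and n :: nat
  defines "A \<equiv> fps_of_poly (st_eulerian_poly s t n)"
  shows "fps_of_poly (st_eulerian_poly s t (Suc n)) =
           fps_const s * A + fps_const (of_nat n + t) * (fps_X * A)
           + fps_X * fps_deriv A - fps_X * (fps_X * fps_deriv A)"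
proof (rule fps_ext)
  fix k
  show "fps_of_poly (st_eulerian_poly s t (Suc n)) $ k =
          (fps_const s * A + fps_const (of_nat n + t) * (fps_X * A)
           + fps_X * fps_deriv A - fps_X * (fps_X * fps_deriv A)) $ k"
  proof (cases k)
    case 0
    then show ?thesis
      using st_eulerian_Suc_0[of s t n] by (simp add: A_def coeff_st_eulerian_poly)
  next
    case (Suc j)
    show ?thesis
      unfolding Suc A_def fps_of_poly_nth coeff_st_eulerian_poly st_eulerian_Suc_Suc
      by (cases j) (simp_all add: coeff_st_eulerian_poly algebra_simps)
  qed
qed

lemma fps_deriv_one_minus_X_powr_neg:
  "fps_deriv (one_minus_X_powr_neg a) = fps_const a * one_minus_X_powr_neg (a + 1)"
proof (rule fps_ext)
  fix j
  have "of_nat (Suc j) / fact (Suc j) = (1 / fact j :: 'a)"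
    by (simp add: field_simps del: of_nat_Suc)
  then show "fps_deriv (one_minus_X_powr_neg a) $ j =
               (fps_const a * one_minus_X_powr_neg (a + 1)) $ j"
    by (simp add: one_minus_X_powr_neg_def pochhammer_rec field_simps del: fact_Suc of_nat_Suc)
qed

text \<open>
  Comparing coefficients, this is Pascal's rule for rising factorials,
  \<open>(a + 1) \<dots> (a + j + 1) - (j + 1) (a + 1) \<dots> (a + j) = a (a + 1) \<dots> (a + j)\<close>.
\<close>

lemma one_minus_X_powr_neg_reduce:
  "(1 - fps_X) * one_minus_X_powr_neg (a + 1) = one_minus_X_powr_neg a"
proof (rule fps_ext)
  fix k
  show "((1 - fps_X) * one_minus_X_powr_neg (a + 1)) $ k = one_minus_X_powr_neg a $ k"
  proof (cases k)
    case 0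
    then show ?thesis by (simp add: one_minus_X_powr_neg_def)
  next
    case (Suc j)
    have "pochhammer (a + 1) (Suc j) - of_nat (Suc j) * pochhammer (a + 1) j
            = pochhammer a (Suc j)"
      unfolding pochhammer_rec[of a] pochhammer_Suc[of "a + 1"] by (simp add: algebra_simps)
    moreover have "pochhammer (a + 1) j / fact j
            = of_nat (Suc j) * pochhammer (a + 1) j / fact (Suc j)"
      by (simp add: field_simps del: of_nat_Suc)
    ultimately show ?thesis
      unfolding Suc one_minus_X_powr_neg_def
      by (simp add: ring_distribs(4) left_diff_distrib diff_divide_distrib[symmetric]
               del: fact_Suc of_nat_Suc pochhammer_Suc)
  qed
qed

text \<open>
  In \<open>s F\<^sub>n + x F\<^sub>n'\<close>, pulling out \<open>(1 - x)\<^sup>-\<^sup>(\<^sup>a\<^sup>+\<^sup>1\<^sup>)\<close> leaves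
  \<open>(1 - x) (s A\<^sub>n + x A\<^sub>n') + a x A\<^sub>n\<close>, and \<open>a - s = n + t\<close> turns this into \<open>A\<^sub>n\<^sub>+\<^sub>1\<close>.
\<close>

lemma st_eulerian_quotient_Suc:
  fixes s t :: "'a::field_char_0" and n :: nat
  defines "F \<equiv> \<lambda>n. fps_of_poly (st_eulerian_poly s t n) * one_minus_X_powr_neg (of_nat n + s + t)"
  shows "F (Suc n) = fps_const s * F n + fps_X * fps_deriv (F n)"
proof -
  define A where "A = fps_of_poly (st_eulerian_poly s t n)"
  define a where "a = of_nat n + s + t"
  define B where "B = one_minus_X_powr_neg (a + 1)"
  have Fn: "F n = A * ((1 - fps_X) * B)"
    by (simp add: F_def A_def B_def a_def one_minus_X_powr_neg_reduce)
  have "fps_deriv (F n) = fps_deriv A * ((1 - fps_X) * B) + A * (fps_const a * B)"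
    unfolding F_def A_def B_def one_minus_X_powr_neg_reduce
    by (simp add: a_def fps_deriv_one_minus_X_powr_neg algebra_simps)
  moreover have "F (Suc n) =
      (fps_const s * A + fps_const (of_nat n + t) * (fps_X * A)
       + fps_X * fps_deriv A - fps_X * (fps_X * fps_deriv A)) * B"
    unfolding F_def st_eulerian_poly_Suc A_def B_def a_def by (simp add: add_ac)
  moreover have "fps_const a = fps_const s + fps_const (of_nat n + t)"
    by (simp add: a_def add_ac)
  ultimately show ?thesis
    unfolding Fn by (simp only:) (simp only: algebra_simps mult_1_left mult_1_right)
qed

lemma st_eulerian_quotient_nth:
  "(fps_of_poly (st_eulerian_poly s t n) * one_minus_X_powr_neg (of_nat n + s + t)) $ j =
     pochhammer (s + t) j / fact j * (of_nat j + s) ^ n"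
proof (induction n)
  case 0
  then show ?case
    by (simp add: st_eulerian_poly_0 one_minus_X_powr_neg_def)
next
  case (Suc n)
  have eigen: "(fps_const s * G + fps_X * fps_deriv G) $ j = (of_nat j + s) * G $ j" for G
    by (cases j) (simp_all add: algebra_simps)
  show ?case
    unfolding st_eulerian_quotient_Suc eigen Suc.IH by simp
qed

theorem proposition12:
  fixes s t :: "'a::field_char_0" and n :: nat
  shows "fps_X * fps_of_poly (st_eulerian_poly s t n) * one_minus_X_powr_neg (of_nat n + s + t)
       = Abs_fps (\<lambda>k. if k \<ge> 1
           then pochhammer (s + t) (k - 1) / fact (k - 1) * (of_nat k + s - 1) ^ n
           else 0)"
proof (rule fps_ext)
  fix k
  show "(fps_X * fps_of_poly (st_eulerian_poly s t n)
           * one_minus_X_powr_neg (of_nat n + s + t)) $ k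
       = Abs_fps (\<lambda>k. if k \<ge> 1
           then pochhammer (s + t) (k - 1) / fact (k - 1) * (of_nat k + s - 1) ^ n
           else 0) $ k"
    unfolding mult.assoc
    by (cases k) (simp_all add: st_eulerian_quotient_nth)
qed

end
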